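(* Let the Fishburn numbers $\xi(n)$ be defined by the formal power series identity $$\sum_{n=0}^\infty \xi(n)q^n=\sum_{n=0}^\infty (1-q;1-q)_n = 1+\sum_{n=1}^\infty\prod_{j=1}^n\bigl(1-(1-q)^j\bigr).$$ Let $p$ be a prime, let $S(p)$ be the set of $j$ with $0\le j\le p-1$ such that $j\equiv m(3m-1)/2\pmod p$ for some integer $m$, and let $T(p)$ be the set of $k$ with $0\le k\le p-1$ such that $k$ is larger than every element of $S(p)$. If $i\in T(p)$, then for all $n\ge 0$, $$\xi(pn+i)\equiv 0\pmod p.$$
   Context: $(A;q)_n=(1-A)(1-Aq)\cdots(1-Aq^{n-1})$, with $(A;q)_0=1$. The series defining $\xi(n)$ is a well-defined formal power series since the $n$-th term is divisible by $q^n$. *)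

theory Defs
  imports "HOL-Computational_Algebra.Computational_Algebra" "HOL-Number_Theory.Cong"
begin

definition qpochhammer :: "'a::comm_ring_1 \<Rightarrow> 'a \<Rightarrow> nat \<Rightarrow> 'a" where
  "qpochhammer a q n = (\<Prod>i<n. 1 - a * q ^ i)"

text \<open>The infinite sum is taken in the metric topology on formal power series, that is,
  coefficientwise with eventually constant partial sums; its convergence is proved below.\<close>

definition fishburn_fps :: "int fps" where
  "fishburn_fps = (\<Sum>n. qpochhammer (1 - fps_X) (1 - fps_X) n)"

definition fishburn :: "nat \<Rightarrow> int" where
  "fishburn n = fps_nth fishburn_fps n"

text \<open>The division by 2 is exact, since \<open>m * (3 * m - 1)\<close> is always even.\<close>

definition pent_residues :: "nat \<Rightarrow> nat set" where
  "pent_residues p = {j. j \<le> p - 1 \<and> (\<exists>m::int. [int j = m * (3 * m - 1) div 2] (mod int p))}"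

definition above_pent_residues :: "nat \<Rightarrow> nat set" where
  "above_pent_residues p = {k. k \<le> p - 1 \<and> (\<forall>j\<in>pent_residues p. j < k)}"

lemma qpochhammer_diag:
  "qpochhammer q q n = (\<Prod>j=1..n. 1 - q ^ j)"
proof -
  have "(\<Prod>j=1..n. 1 - q ^ j) = (\<Prod>i<n. 1 - q ^ Suc i)"
    by (rule prod.reindex_bij_witness[of _ Suc "\<lambda>j. j - 1"]) auto
  then show ?thesis
    by (simp add: qpochhammer_def)
qed

lemma fps_X_power_dvd_qpochhammer:
  "(fps_X :: int fps) ^ n dvd qpochhammer (1 - fps_X) (1 - fps_X) n"
proof -
  have dvd: "(fps_X :: int fps) dvd 1 - (1 - fps_X) ^ j" for j
  proof -
    have "1 - (1 - fps_X :: int fps) dvd 1 ^ j - (1 - fps_X) ^ j"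
      by (metis dvd_triv_left power_diff_sumr2)
    then show ?thesis by simp
  qed
  have "(\<Prod>j=1..n. (fps_X :: int fps)) dvd (\<Prod>j=1..n. 1 - (1 - fps_X) ^ j)"
    by (intro prod_dvd_prod dvd)
  then show ?thesis
    by (simp add: qpochhammer_diag)
qed

lemma qpochhammer_nth_eq_0:
  assumes "k < n"
  shows "fps_nth (qpochhammer (1 - fps_X) (1 - fps_X) n :: int fps) k = 0"
  using fps_X_power_dvd_qpochhammer[of n] assms
  by (auto simp: dvd_def fps_X_power_mult_nth)

lemma fishburn_fps_sums:
  "(\<lambda>n. qpochhammer (1 - fps_X) (1 - fps_X) n) sums fishburn_fps"
proof -
  define f :: "nat \<Rightarrow> int fps" where "f = (\<lambda>n. qpochhammer (1 - fps_X) (1 - fps_X) n)"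
  define g where "g = Abs_fps (\<lambda>k. \<Sum>n\<le>k. fps_nth (f n) k)"
  have "f sums g"
    unfolding sums_def
  proof (rule tendsto_fpsI)
    fix k
    show "eventually (\<lambda>N. fps_nth (\<Sum>n<N. f n) k = fps_nth g k) sequentially"
      using eventually_gt_at_top[of k]
    proof eventually_elim
      case (elim N)
      have "(\<Sum>n<N. fps_nth (f n) k) = (\<Sum>n\<le>k. fps_nth (f n) k)"
        using elim by (intro sum.mono_neutral_right) (auto simp: f_def qpochhammer_nth_eq_0)
      then show ?case by (simp add: g_def fps_sum_nth)
    qed
  qed
  then show ?thesis
    unfolding fishburn_fps_def f_def by (simp add: sums_iff)
qed

lemma fishburn_altdef:
  "Abs_fps fishburn = (\<Sum>n. \<Prod>j=1..n. 1 - (1 - fps_X) ^ j)"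
  by (simp add: fps_eq_iff fishburn_def fishburn_fps_def qpochhammer_diag)

end

theory Submission
  imports Defs
begin

text \<open>
  Zagier's series \<open>F(y) = \<Sum>n. (y;q)\<^sub>n\<^sub>+\<^sub>1 y^n\<close> satisfies \<open>F(y) = 1 - q y^2 - q^2 y^3 F(q y)\<close>.
  If \<open>q^P = 1\<close> with \<open>P\<close> odd, truncating at \<open>P\<close> terms and iterating \<open>P\<close> times expresses \<open>F\<close>
  through pentagonal powers of \<open>q\<close>; the derivative at \<open>y = 1\<close> is an exact finite form of Zagier's
  strange identity for \<open>2 * (\<Sum>n<P. (q;q)\<^sub>n)\<close>. Since it holds at all complex \<open>P\<close>-th roots of unity,
  it holds in \<open>\<int>[q]\<close> modulo \<open>q^P - 1\<close>. For \<open>P = p^e\<close> and \<open>q = 1 - X\<close> this modulus is \<open>-X^P\<close>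
  modulo \<open>p\<close>, so up to order \<open>P\<close> the numbers \<open>2 \<xi>(k)\<close> are modulo \<open>p\<close> combinations of
  binomial coefficients \<open>m choose k\<close> with \<open>m\<close> pentagonal, and these vanish modulo \<open>p\<close> when
  \<open>m mod p < k mod p\<close>.
\<close>

text \<open>The pentagonal number \<open>m * (3 * m - 1) div 2\<close> for \<open>m = - k\<close>; the one for \<open>m = k + 1\<close> is
  \<open>pent k + 2 * k + 1\<close>.\<close>

definition pent :: "nat \<Rightarrow> nat" where
  "pent k = k * (3 * k + 1) div 2"

lemma double_pent: "2 * pent k = k * (3 * k + 1)"
  by (simp add: pent_def)

lemma pent_Suc: "pent (Suc k) = pent k + 3 * k + 2"
  using double_pent [of k] double_pent [of "Suc k"] by (simp add: algebra_simps)

section \<open>The truncated functional equation of Zagier's series\<close>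

lemma qpochhammer_0 [simp]: "qpochhammer a q 0 = 1"
  by (simp add: qpochhammer_def)

lemma qpochhammer_Suc: "qpochhammer a q (Suc n) = qpochhammer a q n * (1 - a * q ^ n)"
  by (simp add: qpochhammer_def)

lemma qpochhammer_Suc_shift: "qpochhammer a q (Suc n) = (1 - a) * qpochhammer (a * q) q n"
  by (simp add: qpochhammer_def prod.lessThan_Suc_shift mult.assoc del: prod.lessThan_Suc)

text \<open>Replacing \<open>a\<close> by \<open>a * q\<close> drops the factor \<open>1 - a\<close>
  and gains \<open>1 - a * q ^ P\<close>, which is the same factor.\<close>

lemma qpochhammer_periodic:
  assumes "q ^ P = 1"
  shows "qpochhammer (a * q) q P = qpochhammer a q P"
proof (cases P)
  case (Suc n)
  have "q * q ^ n = 1" using assms Suc by simp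
  then have "1 - a * q * q ^ n = 1 - a" by (simp add: mult.assoc)
  then have "qpochhammer (a * q) q (Suc n) = (1 - a) * qpochhammer (a * q) q n"
    by (simp add: qpochhammer_Suc)
  then show ?thesis by (simp add: Suc qpochhammer_Suc_shift)
qed simp

definition zagier_sum :: "'a::comm_ring_1 \<Rightarrow> nat \<Rightarrow> 'a \<Rightarrow> 'a" where
  "zagier_sum q N y = (\<Sum>n<N. qpochhammer y q (Suc n) * y ^ n)"

text \<open>The functional equation of the full series, with the boundary term left by truncation at
  \<open>N\<close>; no assumption on \<open>q\<close> enters.\<close>

lemma zagier_sum_step:
  "zagier_sum q N y = 1 - q * y\<^sup>2 - qpochhammer (y * q) q N * y ^ N * (1 - q ^ Suc N * y\<^sup>2)
     - q\<^sup>2 * y ^ 3 * zagier_sum q N (y * q)"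
proof (induction N)
  case 0
  show ?case by (simp add: zagier_sum_def)
next
  case (Suc N)
  define w X where "w = qpochhammer (y * q) q N * y ^ N" and "X = q ^ N"
  have 1: "zagier_sum q (Suc N) y = zagier_sum q N y + (1 - y) * w"
    by (simp add: zagier_sum_def qpochhammer_Suc_shift w_def mult.assoc)
  have 2: "zagier_sum q (Suc N) (y * q) = zagier_sum q N (y * q) + w * (1 - y * q * X) * X"
    by (simp add: zagier_sum_def qpochhammer_Suc w_def X_def power_mult_distrib mult_ac)
  have 3: "qpochhammer (y * q) q (Suc N) * y ^ Suc N = w * (1 - y * q * X) * y"
    by (simp add: qpochhammer_Suc w_def X_def mult_ac)
  have 4: "q ^ Suc N = q * X" "q ^ Suc (Suc N) = q * q * X" by (simp_all add: X_def mult_ac)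
  show ?case
    unfolding 1 2 3 4 Suc.IH unfolding 4 w_def [symmetric]
    by (simp add: algebra_simps power2_eq_square power3_eq_cube)
qed

text \<open>For \<open>q ^ P = 1\<close> the boundary term is
  \<open>y ^ P * qpochhammer y q P * (1 - q * y\<^sup>2)\<close>. Its first two factors are
  unchanged under \<open>y\<close> to \<open>y * q\<close>, so one common factor comes out of all
  steps. The powers \<open>q ^ (3 * K + 2)\<close> accumulate to \<open>q ^ pent K\<close>.\<close>

lemma zagier_sum_iterate:
  assumes "q ^ P = 1"
  shows "zagier_sum q P y =
    (1 - y ^ P * qpochhammer y q P) *
      (\<Sum>k<K. (-1) ^ k * y ^ (3 * k) * q ^ pent k * (1 - y\<^sup>2 * q ^ (2 * k + 1)))
    + (-1) ^ K * y ^ (3 * K) * q ^ pent K * zagier_sum q P (y * q ^ K)"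
proof (induction K)
  case 0
  show ?case by (simp add: pent_def)
next
  case (Suc K)
  define z where "z = y ^ P * qpochhammer y q P"
  have poch: "qpochhammer (y * q ^ k) q P = qpochhammer y q P" for k
  proof (induction k)
    case (Suc k)
    then show ?case
      using qpochhammer_periodic [OF assms, of "y * q ^ k"] by (simp add: mult_ac)
  qed simp
  have pw: "(q ^ K) ^ P = 1"
    by (metis assms power_commuting_commutes power_mult mult.commute power_one)
  have step: "zagier_sum q P (y * q ^ K) = (1 - z) * (1 - y\<^sup>2 * q ^ (2 * K + 1))
     - y ^ 3 * q ^ (3 * K + 2) * zagier_sum q P (y * q ^ Suc K)"
  proof -
    have e: "y * q ^ K * q = y * q ^ Suc K" by (simp add: mult_ac)
    have s1: "q * (y * q ^ K)\<^sup>2 = y\<^sup>2 * q ^ (2 * K + 1)"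
      by (simp add: power_mult_distrib power_add mult_ac flip: power_mult)
    have s2: "q\<^sup>2 * (y * q ^ K) ^ 3 = y ^ 3 * q ^ (3 * K + 2)"
      by (simp add: power_mult_distrib power_add power2_eq_square mult_ac flip: power_mult)
    have s3: "q ^ Suc P * (y * q ^ K)\<^sup>2 = y\<^sup>2 * q ^ (2 * K + 1)"
      using s1 assms by simp
    have s4: "(y * q ^ K) ^ P = y ^ P" using pw by (simp add: power_mult_distrib)
    show ?thesis
      by (subst zagier_sum_step) (simp only: e s1 s2 s3 s4 poch z_def, simp add: algebra_simps)
  qed
  show ?case
    unfolding Suc.IH step z_def [symmetric]
    by (simp add: pent_Suc power_add algebra_simps power3_eq_cube power2_eq_square)
qed

text \<open>After \<open>P\<close> steps the argument is \<open>y\<close> again. Oddness of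
  \<open>P\<close> gives the sign -1 and makes \<open>pent P\<close> a multiple of \<open>P\<close>,
  so the equation can be solved for the sum.\<close>

lemma zagier_sum_periodic:
  assumes "q ^ P = 1" and "odd P"
  shows "(1 + y ^ (3 * P)) * zagier_sum q P y = (1 - y ^ P * qpochhammer y q P) *
      (\<Sum>k<P. (-1) ^ k * y ^ (3 * k) * q ^ pent k * (1 - y\<^sup>2 * q ^ (2 * k + 1)))"
proof -
  have "2 dvd 3 * P + 1" using assms(2) by simp
  then have "pent P = P * ((3 * P + 1) div 2)"
    unfolding pent_def by (rule div_mult_swap [symmetric])
  then have "q ^ pent P = 1" by (simp only: power_mult assms(1) power_one)
  then show ?thesis
    using zagier_sum_iterate [OF assms(1), of y P] assms by (simp add: algebra_simps)
qed

section \<open>The strange identity at roots of unity\<close>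

text \<open>Minus the \<open>y\<close>-derivative at \<open>y = 1\<close> of the sum over
  \<open>k\<close> in \<open>zagier_sum_periodic\<close>.\<close>

definition pent_sum :: "nat \<Rightarrow> 'a::comm_ring_1 \<Rightarrow> 'a" where
  "pent_sum P q = (\<Sum>k<P. (-1) ^ k *
     (of_nat (3 * k + 2) * q ^ (pent k + 2 * k + 1) - of_nat (3 * k) * q ^ pent k))"

lemma poly_qpochhammer: "poly (qpochhammer a q n) x = qpochhammer (poly a x) (poly q x) n"
  by (simp add: qpochhammer_def poly_prod)

lemma pderiv_sum: "pderiv (sum f A) = (\<Sum>x\<in>A. pderiv (f x))"
  by (induction A rule: infinite_finite_induct) (simp_all add: pderiv_add)

lemma strange_identity_root_of_unity:
  fixes q :: "'a::idom"
  assumes "q ^ P = 1" and "odd P"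
  shows "2 * (\<Sum>n<P. qpochhammer q q n) = pent_sum P q"
proof -
  \<comment> \<open>The variable \<open>y\<close> becomes the polynomial indeterminate, so that \<open>pderiv\<close> differentiates in \<open>y\<close>.\<close>
  define Y Q where "Y = [:0, 1::'a:]" and "Q = [:q:]"
  have Q: "Q ^ n = [:q ^ n:]" for n
    by (induction n) (simp_all add: Q_def one_pCons)
  have Q1: "Q ^ P = 1" using assms by (simp add: Q one_pCons)
  define M where "M = (\<Sum>n<P. qpochhammer (Y * Q) Q n * Y ^ n)"
  define A where "A = (1 + Y ^ (3 * P)) * M"
  define R where "R = (\<Sum>k<P. (-1) ^ k * Y ^ (3 * k) * Q ^ pent k * (1 - Y\<^sup>2 * Q ^ (2 * k + 1)))"
  \<comment> \<open>Writing \<open>P = Suc n\<close> lets the factor \<open>1 - Y\<close> be split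
    off from \<open>qpochhammer Y Q P\<close>.\<close>
  obtain n where n: "P = Suc n" using assms(2) by (cases P) auto
  define B where "B = Y ^ P * qpochhammer (Y * Q) Q n"
  have eq: "(1 - Y) * A = (1 - (1 - Y) * B) * R"
    using zagier_sum_periodic [OF Q1 assms(2), of Y]
    unfolding A_def M_def R_def B_def zagier_sum_def n
    by (simp add: qpochhammer_Suc_shift sum_distrib_left mult_ac del: sum.lessThan_Suc)
  have R1: "poly R 1 = 0"
    using arg_cong [OF eq, of "\<lambda>f. poly f 1"] by (simp add: Y_def)
  \<comment> \<open>The derivative of \<open>(1 - Y) * B\<close> contributes only a multiple of
    \<open>poly R 1\<close>, which is 0.\<close>
  have "poly (pderiv R) 1 = - poly A 1"
    using arg_cong [OF eq, of "\<lambda>f. poly (pderiv f) 1"] R1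
    by (simp add: Y_def pderiv_mult pderiv_diff pderiv_pCons)
  moreover have "poly A 1 = 2 * (\<Sum>n<P. qpochhammer q q n)"
    by (simp add: A_def M_def Y_def Q_def poly_sum poly_qpochhammer)
  moreover have "poly (pderiv R) 1 = - pent_sum P q"
  proof -
    have pdY: "poly (pderiv (Y ^ m)) 1 = of_nat m" for m
      by (cases m) (simp_all add: Y_def pderiv_power_Suc pderiv_pCons del: power_Suc)
    have summand: "poly (pderiv ((-1) ^ k * Y ^ (3 * k) * Q ^ pent k * (1 - Y\<^sup>2 * Q ^ (2 * k + 1)))) 1
      = - ((-1) ^ k * (of_nat (3 * k + 2) * q ^ (pent k + 2 * k + 1)
          - of_nat (3 * k) * q ^ pent k))" for k
    proof -
      have "(-1) ^ k * Y ^ (3 * k) * Q ^ pent k * (1 - Y\<^sup>2 * Q ^ (2 * k + 1)) =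
        smult ((-1) ^ k * q ^ pent k) (Y ^ (3 * k))
          - smult ((-1) ^ k * q ^ (pent k + 2 * k + 1)) (Y ^ (3 * k + 2))"
      proof -
        have m1: "(-1) ^ k = [:(-1::'a) ^ k:]"
          by (induction k) (simp_all add: one_pCons)
        show ?thesis
          unfolding Q m1 by (simp add: algebra_simps power_add power2_eq_square smult_diff_right)
      qed
      then show ?thesis
        by (simp only: pderiv_diff pderiv_smult poly_diff poly_smult pdY) (simp add: algebra_simps)
    qed
    show ?thesis
      unfolding R_def pent_sum_def pderiv_sum poly_sum summand sum_negf ..
  qed
  ultimately show ?thesis by simp
qed

section \<open>Transfer from complex roots of unity to commutative rings\<close>

text \<open>Allows one integer polynomial to be specialised both at complex numbers and at power
  series.\<close>

definition int_poly_eval :: "'a::comm_ring_1 \<Rightarrow> int poly \<Rightarrow> 'a" where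
  "int_poly_eval z f = poly (map_poly of_int f) z"

lemma int_poly_eval_0 [simp]: "int_poly_eval z 0 = 0"
  by (simp add: int_poly_eval_def)

lemma int_poly_eval_pCons [simp]:
  "int_poly_eval z (pCons a f) = of_int a + z * int_poly_eval z f"
  by (simp add: int_poly_eval_def map_poly_pCons)

lemma int_poly_eval_add [simp]: "int_poly_eval z (f + g) = int_poly_eval z f + int_poly_eval z g"
  by (induction f g rule: poly_induct2) (simp_all add: algebra_simps)

lemma int_poly_eval_smult [simp]: "int_poly_eval z (smult c f) = of_int c * int_poly_eval z f"
  by (induction f) (simp_all add: algebra_simps)

lemma int_poly_eval_mult [simp]: "int_poly_eval z (f * g) = int_poly_eval z f * int_poly_eval z g"
  by (induction f) (simp_all add: algebra_simps)

lemma int_poly_eval_1 [simp]: "int_poly_eval z 1 = 1"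
  by (simp add: one_pCons)

lemma int_poly_eval_diff [simp]: "int_poly_eval z (f - g) = int_poly_eval z f - int_poly_eval z g"
  using int_poly_eval_add [of z "f - g" g] by (simp del: int_poly_eval_add add: eq_diff_eq)

lemma int_poly_eval_power [simp]: "int_poly_eval z (f ^ n) = int_poly_eval z f ^ n"
  by (induction n) simp_all

lemma int_poly_eval_sum [simp]: "int_poly_eval z (sum f A) = (\<Sum>x\<in>A. int_poly_eval z (f x))"
  by (induction A rule: infinite_finite_induct) simp_all

lemma int_poly_eval_prod [simp]: "int_poly_eval z (prod f A) = (\<Prod>x\<in>A. int_poly_eval z (f x))"
  by (induction A rule: infinite_finite_induct) simp_all

lemma int_poly_eval_of_nat [simp]: "int_poly_eval z (of_nat n) = of_nat n"
  by (induction n) simp_all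

text \<open>The remainder of \<open>f\<close> modulo \<open>[:0, 1:] ^ P - 1\<close> has degree
  below \<open>P\<close> or is 0, yet vanishes at \<open>P\<close> distinct complex numbers.\<close>

lemma roots_of_unity_imp_dvd:
  assumes "P > 0" and "\<And>\<zeta>::complex. \<zeta> ^ P = 1 \<Longrightarrow> int_poly_eval \<zeta> f = 0"
  shows "[:0, 1:] ^ P - 1 dvd f"
proof -
  define g :: "int poly" where "g = [:0, 1:] ^ P - 1"
  have g: "g = monom 1 P - 1" by (simp add: g_def monom_altdef)
  have deg: "degree g = P"
    unfolding g using assms(1)
    by (intro antisym degree_diff_le degree_monom_le le_degree) auto
  have lc: "coeff g (degree g) = 1"
    unfolding deg using assms(1) by (simp add: g)
  then have "g \<noteq> 0" by auto
  \<comment> \<open>The divisor is monic, so pseudo-division is genuine division over the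
    integers.\<close>
  obtain q r where "pseudo_divmod f g = (q, r)" by fastforce
  from pseudo_divmod [OF \<open>g \<noteq> 0\<close> this] have f: "f = g * q + r" and r: "r = 0 \<or> degree r < P"
    unfolding lc by (simp_all add: deg)
  define R :: "complex poly" where "R = map_poly of_int r"
  have "R = 0"
  proof (rule ccontr)
    assume "R \<noteq> 0"
    have "{\<zeta>. \<zeta> ^ P = 1} \<subseteq> {\<zeta>. poly R \<zeta> = 0}"
    proof safe
      fix \<zeta> :: complex
      assume "\<zeta> ^ P = 1"
      then show "poly R \<zeta> = 0"
        using assms(2) [of \<zeta>] unfolding f R_def int_poly_eval_def [symmetric]
        by (simp add: g_def)
    qed
    then have "card {\<zeta>::complex. \<zeta> ^ P = 1} \<le> card {\<zeta>. poly R \<zeta> = 0}"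
      using poly_roots_finite [OF \<open>R \<noteq> 0\<close>] by (rule card_mono [rotated])
    then have "P \<le> degree R"
      using card_poly_roots_bound [OF \<open>R \<noteq> 0\<close>] card_roots_unity_eq [OF assms(1)] by simp
    moreover have "degree R \<le> degree r" unfolding R_def
      by (intro degree_le) (simp add: coeff_map_poly coeff_eq_0)
    moreover have "r \<noteq> 0" using \<open>R \<noteq> 0\<close> by (auto simp: R_def)
    ultimately show False using r by simp
  qed
  then have "r = 0" by (auto simp: R_def poly_eq_iff coeff_map_poly)
  then show ?thesis using f by (simp add: g_def)
qed

lemma strange_identity_dvd:
  fixes q :: "'a::comm_ring_1"
  assumes "odd P"
  shows "q ^ P - 1 dvd 2 * (\<Sum>n<P. qpochhammer q q n) - pent_sum P q"
proof -
  define D :: "int poly" where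
    "D = 2 * (\<Sum>n<P. qpochhammer [:0, 1:] [:0, 1:] n) - pent_sum P [:0, 1:]"
  have eval_D: "int_poly_eval z D = 2 * (\<Sum>n<P. qpochhammer z z n) - pent_sum P z"
    for z :: "'b::comm_ring_1"
  proof -
    have m1: "int_poly_eval z (-1) = -1"
      using int_poly_eval_diff [of z 0 1] by (simp del: int_poly_eval_diff)
    have two: "int_poly_eval z 2 = 2"
      using int_poly_eval_of_nat [of z 2] by (simp del: int_poly_eval_of_nat)
    show ?thesis
      by (simp add: D_def qpochhammer_def pent_sum_def m1 two mult.left_commute algebra_simps
          del: of_nat_add of_nat_mult)
  qed
  have "P > 0" using assms by (cases P) auto
  then have "[:0, 1:] ^ P - 1 dvd D"
    by (rule roots_of_unity_imp_dvd)
      (simp add: eval_D strange_identity_root_of_unity assms)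
  then obtain E where E: "D = ([:0, 1:] ^ P - 1) * E" by (elim dvdE)
  have "int_poly_eval q D = (q ^ P - 1) * int_poly_eval q E"
    unfolding E by simp
  then show ?thesis unfolding eval_D by simp
qed

section \<open>Binomial coefficients modulo a prime\<close>

lemma fps_nth_one_minus_X_power:
  "fps_nth ((1 - fps_X) ^ m :: 'a::comm_ring_1 fps) k = (-1) ^ k * of_nat (m choose k)"
proof (induction m arbitrary: k)
  case (Suc m)
  then show ?case
    by (cases k) (simp_all add: ring_distribs)
next
  case 0
  show ?case by (cases k) simp_all
qed

text \<open>The last-digit case of Lucas' theorem. Vandermonde for \<open>p + m'\<close> leaves,
  modulo \<open>p\<close>, only the terms \<open>t = 0\<close> and \<open>t = p\<close>, and both
  preserve the residues of \<open>m\<close> and \<open>k\<close>.\<close>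

lemma prime_dvd_choose_mod_less:
  assumes "prime p" and "m mod p < k mod p"
  shows "p dvd (m choose k)"
  using assms(2)
proof (induction m arbitrary: k rule: less_induct)
  case (less m)
  show ?case
  proof (cases "m < p")
    case True
    then have "m < k" using less.prems by (metis mod_less mod_less_eq_dividend order_less_le_trans)
    then show ?thesis by (simp add: binomial_eq_0)
  next
    case False
    define m' where "m' = m - p"
    have m: "m = p + m'" using False by (simp add: m'_def)
    have "m' < m" using m prime_gt_0_nat [OF assms(1)] by linarith
    have m'_mod: "m' mod p = m mod p" unfolding m by simp
    have "p dvd (p choose t) * (m' choose (k - t))" if "t \<le> k" for t
    proof -
      consider "t = 0" | "t = p" | "0 < t" "t < p" | "p < t" by linarith
      then show ?thesis
      proof cases
        case 1
        then show ?thesis using less.IH [OF \<open>m' < m\<close>, of k] less.prems m'_mod by simp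
      next
        case 2
        then have "(k - p) mod p = k mod p" using that by (simp add: le_mod_geq)
        then show ?thesis
          using less.IH [OF \<open>m' < m\<close>, of "k - p"] less.prems m'_mod 2 by simp
      next
        case 3
        then show ?thesis using dvd_choose_prime [of t p] assms(1) by simp
      qed (simp add: binomial_eq_0)
    qed
    then show ?thesis
      unfolding m vandermonde [symmetric] by (intro dvd_sum) simp
  qed
qed

text \<open>Since \<open>p ^ e\<close> divides \<open>k * (p ^ e choose k)\<close>, a binomial
  coefficient prime to \<open>p\<close> would force \<open>p ^ e\<close> to divide the smaller
  \<open>k\<close>.\<close>

lemma prime_dvd_choose_prime_power:
  fixes p :: nat
  assumes "prime p" and "0 < k" and "k < p ^ e"
  shows "p dvd (p ^ e choose k)"
proof (rule ccontr)
  assume "\<not> p dvd (p ^ e choose k)"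
  then have "coprime (p ^ e) (p ^ e choose k)"
    using assms(1) by (simp add: prime_imp_coprime)
  moreover have "p ^ e dvd k * (p ^ e choose k)"
    using times_binomial_minus1_eq [OF assms(2), of "p ^ e"] by simp
  ultimately have "p ^ e dvd k" by (simp add: coprime_dvd_mult_left_iff)
  then show False using assms(2,3) by (auto dest: dvd_imp_le)
qed

section \<open>Coefficients of the Fishburn series modulo a prime\<close>

lemma fishburn_eq_partial_sum:
  assumes "k < N"
  shows "fishburn k = fps_nth (\<Sum>n<N. qpochhammer (1 - fps_X) (1 - fps_X) n) k"
proof -
  let ?f = "\<lambda>n. qpochhammer (1 - fps_X) (1 - fps_X) n :: int fps"
  have "eventually (\<lambda>M. fps_nth (\<Sum>n<M. ?f n) k = fishburn k) sequentially"
    using fishburn_fps_sums unfolding sums_def tendsto_fps_iff fishburn_def by simp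
  then have "eventually (\<lambda>M. M \<ge> N \<and> fps_nth (\<Sum>n<M. ?f n) k = fishburn k) sequentially"
    using eventually_ge_at_top [of N] by eventually_elim simp
  then obtain M where M: "M \<ge> N" "fps_nth (\<Sum>n<M. ?f n) k = fishburn k"
    by (auto dest: eventually_happens)
  have "(\<Sum>n<M. fps_nth (?f n) k) = (\<Sum>n<N. fps_nth (?f n) k)"
    using M(1) assms by (intro sum.mono_neutral_right) (auto simp: qpochhammer_nth_eq_0)
  then show ?thesis using M(2) by (simp add: fps_sum_nth)
qed

lemma pent_mod_in_pent_residues:
  assumes "p > 0" and "int m = M * (3 * M - 1) div 2"
  shows "m mod p \<in> pent_residues p"
proof -
  have "m mod p < p" using assms(1) by simp
  then have "m mod p \<le> p - 1" by simp
  moreover have "[int (m mod p) = M * (3 * M - 1) div 2] (mod int p)"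
    unfolding assms(2) [symmetric] by (simp add: cong_def zmod_int)
  ultimately show ?thesis unfolding pent_residues_def by blast
qed

lemma pent_eq_int: "int (pent k) = - int k * (3 * (- int k) - 1) div 2"
proof -
  have "- int k * (3 * (- int k) - 1) = 2 * int (pent k)"
    using arg_cong [OF double_pent [of k], of int] by (simp add: algebra_simps)
  then show ?thesis by simp
qed

lemma pent_add_eq_int:
  "int (pent k + 2 * k + 1) = int (Suc k) * (3 * int (Suc k) - 1) div 2"
proof -
  have "int (Suc k) * (3 * int (Suc k) - 1) = 2 * int (pent k + 2 * k + 1)"
    using arg_cong [OF double_pent [of k], of int] by (simp add: algebra_simps)
  then show ?thesis by (simp only:) simp
qed

text \<open>Every exponent in \<open>pent_sum\<close> is pentagonal, so its residue modulo
  \<open>p\<close> lies below \<open>i\<close>.\<close>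

lemma pent_sum_nth_dvd:
  assumes "prime p" and "i \<in> above_pent_residues p"
  shows "int p dvd fps_nth (pent_sum P (1 - fps_X) :: int fps) (p * n + i)"
proof -
  have "i < p" using assms prime_gt_0_nat [OF assms(1)] by (auto simp: above_pent_residues_def)
  have pow: "int p dvd fps_nth ((1 - fps_X) ^ m) (p * n + i)" if "m mod p \<in> pent_residues p" for m
  proof -
    have "m mod p < (p * n + i) mod p"
      using that assms(2) \<open>i < p\<close> by (simp add: above_pent_residues_def)
    then have "p dvd (m choose (p * n + i))" by (rule prime_dvd_choose_mod_less [OF assms(1)])
    then show ?thesis by (simp add: fps_nth_one_minus_X_power)
  qed
  have p: "p > 0" using assms(1) by (rule prime_gt_0_nat)
  have nth: "fps_nth ((-1) ^ k * (of_nat a * f - of_nat b * g)) N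
      = (-1) ^ k * (int a * fps_nth f N - int b * fps_nth g N)"
    for k a b N and f g :: "int fps"
    by (cases "even k") (simp_all add: fps_of_nat [symmetric])
  show ?thesis
    unfolding pent_sum_def fps_sum_nth nth
    by (intro dvd_sum dvd_mult dvd_diff pow pent_mod_in_pent_residues [OF p, OF pent_eq_int]
        pent_mod_in_pent_residues [OF p, OF pent_add_eq_int])
qed

theorem theorem1:
  fixes p i :: nat
  assumes "prime p" and "i \<in> above_pent_residues p"
  shows "\<forall>n::nat. [fishburn (p * n + i) = 0] (mod int p)"
proof
  fix n
  \<comment> \<open>A power of \<open>p\<close> exceeding \<open>N\<close> makes
    \<open>q ^ P - 1\<close> vanish modulo \<open>p\<close> in all degrees up to
    \<open>N\<close>.\<close>
  define N P where "N = p * n + i" and "P = p ^ N"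
  \<comment> \<open>For \<open>p = 2\<close> the largest residue 1 is pentagonal, so no
    \<open>i\<close> is admissible. Oddness is needed for the strange identity and for cancelling
    the factor 2.\<close>
  have "p \<noteq> 2"
  proof
    assume "p = 2"
    moreover have "1 mod p \<in> pent_residues p"
      by (rule pent_mod_in_pent_residues [where M = 1]) (use \<open>p = 2\<close> in auto)
    ultimately show False using assms(2) by (auto simp: above_pent_residues_def)
  qed
  then have "odd p" using assms(1) primes_dvd_imp_eq two_is_prime_nat by blast
  then have "odd P" by (simp add: P_def)
  have "N < P" unfolding P_def using prime_gt_1_nat [OF assms(1)] by (intro power_gt_expt) simp
  define q :: "int fps" where "q = 1 - fps_X"
  obtain E where E: "2 * (\<Sum>n<P. qpochhammer q q n) - pent_sum P q = (q ^ P - 1) * E"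
    using strange_identity_dvd [OF \<open>odd P\<close>, of q] by (elim dvdE)
  have "int p dvd fps_nth (q ^ P - 1) k" if "k \<le> N" for k
  proof (cases "k = 0")
    case False
    then have "p dvd (P choose k)"
      using that \<open>N < P\<close> unfolding P_def
      by (intro prime_dvd_choose_prime_power assms(1)) auto
    then show ?thesis using False by (simp add: q_def fps_nth_one_minus_X_power)
  qed (simp add: q_def fps_nth_one_minus_X_power)
  then have "int p dvd fps_nth ((q ^ P - 1) * E) N"
    unfolding fps_mult_nth by (intro dvd_sum dvd_mult2) auto
  moreover have "int p dvd fps_nth (pent_sum P q) N"
    unfolding q_def N_def by (rule pent_sum_nth_dvd [OF assms])
  ultimately have "int p dvd fps_nth ((q ^ P - 1) * E + pent_sum P q) N"
    unfolding fps_add_nth by (rule dvd_add)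
  moreover have "(q ^ P - 1) * E + pent_sum P q = 2 * (\<Sum>n<P. qpochhammer q q n)"
    unfolding E [symmetric] by simp
  moreover have "fps_nth (2 * (\<Sum>n<P. qpochhammer q q n)) N = 2 * fishburn N"
    unfolding fishburn_eq_partial_sum [OF \<open>N < P\<close>] q_def mult_2 fps_add_nth ..
  ultimately have "int p dvd 2 * fishburn N" by simp
  moreover have "coprime (int p) 2" using \<open>odd p\<close> by simp
  ultimately show "[fishburn (p * n + i) = 0] (mod int p)"
    by (simp add: coprime_dvd_mult_right_iff cong_0_iff N_def)
qed

end
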